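(* Let $l>0$, let $\gamma\colon[0,l]\to\mathbb{R}^3$ be a $C^3$ unit-speed curve with curvature $\kappa>0$ everywhere and torsion $\tau$, and let $$E(\theta)=\int_0^l \frac{\left(\kappa^2\cos^2\theta+(\theta'+\tau)^2\right)^2}{\kappa^2\cos^2\theta}\,dt\in[0,+\infty],\qquad \theta\in W^{1,4}([0,l]).$$ Let $\theta_{\min}$ be a minimizer of $E$ on $W^{1,4}([0,l])$, and let $t_0\in[0,l]$ be a singular point of $\theta_{\min}$ with $\tau(t_0)\neq 0$. Then $t_0$ is an isolated singular point, i.e., there is an $\varepsilon>0$ such that $I_\varepsilon=(t_0-\varepsilon,t_0+\varepsilon)\cap[0,l]$ does not contain any singular point of $\theta_{\min}$ other than $t_0$.
   Context: The integrand of $E$ is understood to be $0$ at any point $t$ where both the numerator and the denominator vanish, and $+\infty$ at any point where the denominator vanishes but the numerator does not. Here $\kappa\in C^1([0,l],\mathbb{R}_{>0})$ and $\tau\in C^0([0,l])$. $W^{1,4}([0,l])$ is the real-valued Sobolev space of functions on $(0,l)$ with weak derivative in $L^4$; each element is identified with its continuous representative on $[0,l]$. A minimizer of $E$ on $W^{1,4}([0,l])$ is a $\theta_{\min}\in W^{1,4}([0,l])$ with $E(\theta_{\min})\le E(\theta)$ for all $\theta\in W^{1,4}([0,l])$. A point $t\in[0,l]$ is a singular point of $\theta\in W^{1,4}([0,l])$ if $\theta(t)\in\frac{\pi}{2}+\pi\mathbb{Z}$. *)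

theory Defs
  imports "HOL-Analysis.Analysis"
begin

section \<open>Curvature and torsion of a unit-speed space curve\<close>

text \<open>Derivatives are taken within \<open>S\<close>, hence are one-sided at the end points of an interval.\<close>

definition vderiv_on :: "real set \<Rightarrow> (real \<Rightarrow> 'a::real_normed_vector) \<Rightarrow> real \<Rightarrow> 'a" where
  "vderiv_on S f = (\<lambda>t. vector_derivative f (at t within S))"

definition Ck_on :: "nat \<Rightarrow> real set \<Rightarrow> (real \<Rightarrow> 'a::real_normed_vector) \<Rightarrow> bool" where
  "Ck_on k S f \<longleftrightarrow>
     (\<forall>j<k. ((vderiv_on S ^^ j) f) differentiable_on S) \<and>
     continuous_on S ((vderiv_on S ^^ k) f)"

definition unit_speed_on :: "real set \<Rightarrow> (real \<Rightarrow> real ^ 3) \<Rightarrow> bool" where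
  "unit_speed_on S \<gamma> \<longleftrightarrow> (\<forall>t\<in>S. norm (vderiv_on S \<gamma> t) = 1)"

text \<open>The following notions are meant for unit-speed curves with nowhere vanishing curvature.
  With the Frenet frame \<open>T\<close>, \<open>N\<close>, \<open>B = T \<times> N\<close>, the sign of the torsion is
  fixed by \<open>N' = - \<kappa> T + \<tau> B\<close>.\<close>

definition tangent_on :: "real set \<Rightarrow> (real \<Rightarrow> real ^ 3) \<Rightarrow> real \<Rightarrow> real ^ 3" where
  "tangent_on S \<gamma> = vderiv_on S \<gamma>"

definition curvature_on :: "real set \<Rightarrow> (real \<Rightarrow> real ^ 3) \<Rightarrow> real \<Rightarrow> real" where
  "curvature_on S \<gamma> t = norm (vderiv_on S (tangent_on S \<gamma>) t)"

definition normal_on :: "real set \<Rightarrow> (real \<Rightarrow> real ^ 3) \<Rightarrow> real \<Rightarrow> real ^ 3" where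
  "normal_on S \<gamma> t = vderiv_on S (tangent_on S \<gamma>) t /\<^sub>R curvature_on S \<gamma> t"

definition binormal_on :: "real set \<Rightarrow> (real \<Rightarrow> real ^ 3) \<Rightarrow> real \<Rightarrow> real ^ 3" where
  "binormal_on S \<gamma> t = cross3 (tangent_on S \<gamma> t) (normal_on S \<gamma> t)"

definition torsion_on :: "real set \<Rightarrow> (real \<Rightarrow> real ^ 3) \<Rightarrow> real \<Rightarrow> real" where
  "torsion_on S \<gamma> t = vderiv_on S (normal_on S \<gamma>) t \<bullet> binormal_on S \<gamma> t"


section \<open>The Sobolev space \<open>W\<^sup>1\<^sup>,\<^sup>4\<close> on an interval\<close>

definition test_function :: "real \<Rightarrow> (real \<Rightarrow> real) \<Rightarrow> bool" where
  "test_function l \<phi> \<longleftrightarrow>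
     (\<forall>n. ((deriv ^^ n) \<phi>) differentiable_on UNIV) \<and>
     compact (closure {t. \<phi> t \<noteq> 0}) \<and> closure {t. \<phi> t \<noteq> 0} \<subseteq> {0<..<l}"

definition locally_integrable :: "real \<Rightarrow> (real \<Rightarrow> real) \<Rightarrow> bool" where
  "locally_integrable l f \<longleftrightarrow>
     (\<forall>a b. 0 < a \<and> b < l \<longrightarrow> f absolutely_integrable_on {a..b})"

definition has_weak_deriv :: "real \<Rightarrow> (real \<Rightarrow> real) \<Rightarrow> (real \<Rightarrow> real) \<Rightarrow> bool" where
  "has_weak_deriv l \<theta> g \<longleftrightarrow>
     locally_integrable l \<theta> \<and> locally_integrable l g \<and>
     (\<forall>\<phi>. test_function l \<phi> \<longrightarrow>
        (LINT t|lebesgue_on {0<..<l}. \<theta> t * deriv \<phi> t) =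
        - (LINT t|lebesgue_on {0<..<l}. g t * \<phi> t))"

text \<open>The weak derivative is determined up to a null set only; an arbitrary representative is
  chosen. It is used only under integrals.\<close>

definition weak_deriv :: "real \<Rightarrow> (real \<Rightarrow> real) \<Rightarrow> real \<Rightarrow> real" where
  "weak_deriv l \<theta> = (SOME g. has_weak_deriv l \<theta> g)"

definition in_L4 :: "real \<Rightarrow> (real \<Rightarrow> real) \<Rightarrow> bool" where
  "in_L4 l f \<longleftrightarrow>
     f \<in> borel_measurable (lebesgue_on {0<..<l}) \<and>
     integrable (lebesgue_on {0<..<l}) (\<lambda>t. f t ^ 4)"

text \<open>Elements are represented by functions that are continuous on \<open>[0,l]\<close>; their values outside
  \<open>[0,l]\<close> are irrelevant.\<close>

definition W14 :: "real \<Rightarrow> (real \<Rightarrow> real) set" where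
  "W14 l = {\<theta>. continuous_on {0..l} \<theta> \<and> in_L4 l \<theta> \<and>
                (\<exists>g. has_weak_deriv l \<theta> g \<and> in_L4 l g)}"


section \<open>The energy, its minimizers and their singular points\<close>

text \<open>Division in \<^typ>\<open>ennreal\<close> satisfies \<open>0 / 0 = 0\<close> and \<open>x / 0 = \<infinity>\<close> for \<open>x \<noteq> 0\<close>, which is
  exactly the convention wanted for the integrand where the denominator vanishes.\<close>

definition energy_density :: "real \<Rightarrow> real \<Rightarrow> real \<Rightarrow> real \<Rightarrow> ennreal" where
  "energy_density k s x v =
     ennreal ((k\<^sup>2 * (cos x)\<^sup>2 + (v + s)\<^sup>2)\<^sup>2) / ennreal (k\<^sup>2 * (cos x)\<^sup>2)"

lemma energy_density_zero_zero:
  "k * cos x = 0 \<Longrightarrow> v + s = 0 \<Longrightarrow> energy_density k s x v = 0"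
  by (auto simp: energy_density_def)

lemma energy_density_nonzero_zero:
  "k * cos x = 0 \<Longrightarrow> v + s \<noteq> 0 \<Longrightarrow> energy_density k s x v = \<infinity>"
  by (auto simp: energy_density_def ennreal_divide_zero)

definition energy ::
    "real \<Rightarrow> (real \<Rightarrow> real) \<Rightarrow> (real \<Rightarrow> real) \<Rightarrow> (real \<Rightarrow> real) \<Rightarrow> ennreal" where
  "energy l \<kappa> \<tau> \<theta> =
     (\<integral>\<^sup>+ t. energy_density (\<kappa> t) (\<tau> t) (\<theta> t) (weak_deriv l \<theta> t) \<partial>lebesgue_on {0..l})"

definition energy_minimizer ::
    "real \<Rightarrow> (real \<Rightarrow> real) \<Rightarrow> (real \<Rightarrow> real) \<Rightarrow> (real \<Rightarrow> real) \<Rightarrow> bool" where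
  "energy_minimizer l \<kappa> \<tau> \<theta> \<longleftrightarrow>
     \<theta> \<in> W14 l \<and> (\<forall>\<eta>\<in>W14 l. energy l \<kappa> \<tau> \<theta> \<le> energy l \<kappa> \<tau> \<eta>)"

definition singular_point :: "real \<Rightarrow> (real \<Rightarrow> real) \<Rightarrow> real \<Rightarrow> bool" where
  "singular_point l \<theta> t \<longleftrightarrow> t \<in> {0..l} \<and> (\<exists>k::int. \<theta> t = pi / 2 + pi * of_int k)"

end

theory Submission
  imports Defs
begin

text \<open>The energy penalises singular points that lie close together. Let \<open>a < b\<close> be two singular
  points of \<open>\<theta>\<close> with \<open>\<theta> a = \<theta> b\<close>, put \<open>h = b - a\<close>, \<open>w = \<theta>' + \<tau>\<close>, and suppose that
  \<open>\<bar>\<tau>\<bar> \<ge> c > 0\<close> with constant sign on \<open>[a,b]\<close>. Let \<open>S = \<integral>\<bar>w\<bar>\<close> over \<open>[a,b]\<close>. Then: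

  \<^item> \<open>S \<ge> c h\<close>, because \<open>\<theta>\<close> returns to its initial value, so that the integrals of \<open>w\<close> and of \<open>\<tau>\<close>
    over \<open>[a,b]\<close> coincide.

  \<^item> \<open>\<bar>\<theta> t - \<theta> a\<bar> \<le> S\<close> on \<open>[a,b]\<close>. Say \<open>\<tau> > 0\<close>, so that \<open>\<theta>' \<le> \<bar>w\<bar>\<close>. An upward excursion of \<open>\<theta>\<close> has to
    be climbed between \<open>a\<close> and \<open>t\<close>, a downward one has to be climbed back between \<open>t\<close> and \<open>b\<close>, and
    climbing costs at least its height in \<open>\<integral>\<bar>w\<bar>\<close>. Since \<open>cos (\<theta> a) = 0\<close>, it follows that
    \<open>\<bar>cos (\<theta> t)\<bar> \<le> S\<close>.

  With an upper bound \<open>K\<close> for \<open>\<kappa>\<close>, the density is therefore at least \<open>w\<^sup>4 / (K\<^sup>2 S\<^sup>2)\<close>, and the power mean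
  inequality \<open>\<integral>w\<^sup>4 \<ge> S\<^sup>4 / h\<^sup>3\<close> bounds the energy \<open>E\<close> below by \<open>S\<^sup>2 / (K\<^sup>2 h\<^sup>3) \<ge> c\<^sup>2 / (K\<^sup>2 h)\<close>. Hence
  \<open>h \<ge> c\<^sup>2 / (K\<^sup>2 E)\<close>; this is \<open>singular_points_gap\<close>.

  A minimizer has finite energy because the competitor \<open>\<theta> = 0\<close> does (\<open>energy_of_zero_finite\<close>). Near a
  singular point \<open>t\<^sub>0\<close> with \<open>\<tau> t\<^sub>0 \<noteq> 0\<close> the torsion keeps away from \<open>0\<close>, and by continuity any other
  singular point close to it has the same value of \<open>\<theta>\<close>, so the gap estimate separates it from \<open>t\<^sub>0\<close>.

  The analytic part makes sense of this for weak derivatives: testing with smooth approximations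
  of the indicator of an interval shows that \<open>\<theta>\<close> is the integral of its weak derivative
  (\<open>weak_derivative_FTC_interior\<close>, \<open>weak_derivative_FTC\<close>). Both the gap estimate and the evaluation of the energy at \<open>0\<close>, where an
  arbitrary representative of the weak derivative enters, depend on it.\<close>

section \<open>Smoothness\<close>

text \<open>\<open>k\<close> times differentiable everywhere. Quantifying over the derivative instead of iterating
  \<open>deriv\<close> makes the closure properties plain inductions on \<open>k\<close>.\<close>

primrec k_smooth :: "nat \<Rightarrow> (real \<Rightarrow> real) \<Rightarrow> bool" where
  "k_smooth 0 f = True"
| "k_smooth (Suc k) f = (\<exists>f'. (\<forall>x. (f has_real_derivative f' x) (at x)) \<and> k_smooth k f')"

lemma k_smooth_SucI:
  assumes "\<And>x. (f has_real_derivative f' x) (at x)" and "k_smooth k f'"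
  shows "k_smooth (Suc k) f"
  using assms by auto

lemma k_smooth_SucE:
  assumes "k_smooth (Suc k) f"
  obtains f' where "\<And>x. (f has_real_derivative f' x) (at x)" and "k_smooth k f'"
  using assms by auto

lemma k_smooth_Suc_lower: "k_smooth (Suc k) f \<Longrightarrow> k_smooth k f"
proof (induction k arbitrary: f)
  case (Suc k)
  obtain f' where "\<And>x. (f has_real_derivative f' x) (at x)" "k_smooth (Suc k) f'"
    using Suc.prems by (rule k_smooth_SucE) blast
  then show ?case by (rule k_smooth_SucI[OF _ Suc.IH])
qed simp

declare k_smooth.simps(2) [simp del]

lemma k_smooth_const: "k_smooth k (\<lambda>x. c)"
proof (induction k arbitrary: c)
  case (Suc k)
  show ?case by (rule k_smooth_SucI[OF DERIV_const Suc.IH])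
qed simp

lemma k_smooth_add: "k_smooth k f \<Longrightarrow> k_smooth k g \<Longrightarrow> k_smooth k (\<lambda>x. f x + g x)"
proof (induction k arbitrary: f g)
  case (Suc k)
  obtain f' where "\<And>x. (f has_real_derivative f' x) (at x)" "k_smooth k f'"
    using Suc.prems(1) by (rule k_smooth_SucE) blast
  moreover obtain g' where "\<And>x. (g has_real_derivative g' x) (at x)" "k_smooth k g'"
    using Suc.prems(2) by (rule k_smooth_SucE) blast
  ultimately show ?case
    by (intro k_smooth_SucI[where f' = "\<lambda>x. f' x + g' x"] Suc.IH DERIV_add)
qed simp

lemma k_smooth_mult: "k_smooth k f \<Longrightarrow> k_smooth k g \<Longrightarrow> k_smooth k (\<lambda>x. f x * g x)"
proof (induction k arbitrary: f g)
  case (Suc k)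
  obtain f' where "\<And>x. (f has_real_derivative f' x) (at x)" "k_smooth k f'"
    using Suc.prems(1) by (rule k_smooth_SucE) blast
  moreover obtain g' where "\<And>x. (g has_real_derivative g' x) (at x)" "k_smooth k g'"
    using Suc.prems(2) by (rule k_smooth_SucE) blast
  ultimately show ?case
    using Suc.prems[THEN k_smooth_Suc_lower]
    by (intro k_smooth_SucI[where f' = "\<lambda>x. f' x * g x + g' x * f x"] k_smooth_add Suc.IH
        DERIV_mult)
qed simp

lemma k_smooth_diff:
  assumes "k_smooth k f" "k_smooth k g" shows "k_smooth k (\<lambda>x. f x - g x)"
  using k_smooth_add[OF assms(1) k_smooth_mult[OF k_smooth_const[of k "-1"] assms(2)]] by simp

lemma k_smooth_affine: "k_smooth k f \<Longrightarrow> k_smooth k (\<lambda>x. f (a * x + b))"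
proof (induction k arbitrary: f)
  case (Suc k)
  obtain f' where f': "\<And>x. (f has_real_derivative f' x) (at x)" "k_smooth k f'"
    using Suc.prems by (rule k_smooth_SucE) blast
  have "((\<lambda>x. f (a * x + b)) has_real_derivative f' (a * x + b) * a) (at x)" for x
    by (rule DERIV_chain2[OF f'(1)]) (auto intro!: derivative_eq_intros)
  then show ?case
    by (rule k_smooth_SucI[OF _ k_smooth_mult[OF Suc.IH[OF f'(2)] k_smooth_const]])
qed simp

lemma k_smooth_inverse:
  assumes "\<And>x. f x \<noteq> 0"
  shows "k_smooth k f \<Longrightarrow> k_smooth k (\<lambda>x. inverse (f x))"
proof (induction k)
  case (Suc k)
  obtain f' where f': "\<And>x. (f has_real_derivative f' x) (at x)" "k_smooth k f'"
    using Suc.prems by (rule k_smooth_SucE) blast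
  have "k_smooth k (\<lambda>x. inverse (f x))"
    by (rule Suc.IH[OF k_smooth_Suc_lower[OF Suc.prems]])
  then have "k_smooth k (\<lambda>x. (-1) * (inverse (f x) * f' x * inverse (f x)))"
    by (intro k_smooth_mult k_smooth_const f')
  then show ?case
    by (rule k_smooth_SucI[rotated]) (use DERIV_inverse'[OF f'(1) assms] in simp)
qed simp

lemma k_smooth_higher_deriv:
  "k_smooth (Suc n) f \<Longrightarrow> ((deriv ^^ n) f) differentiable_on UNIV"
proof (induction n arbitrary: f)
  case 0
  then obtain f' where "\<And>x. (f has_real_derivative f' x) (at x)"
    by (rule k_smooth_SucE) blast
  then show ?case
    unfolding differentiable_on_def real_differentiable_def funpow_0 by blast
next
  case (Suc n)
  obtain f' where f': "\<And>x. (f has_real_derivative f' x) (at x)" "k_smooth (Suc n) f'"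
    using Suc.prems by (rule k_smooth_SucE) blast
  then have "deriv f = f'"
    by (intro ext DERIV_imp_deriv)
  with Suc.IH[OF f'(2)] show ?case
    unfolding funpow_Suc_right o_apply by simp
qed

section \<open>A smooth step function\<close>

text \<open>\<open>flat 0\<close> is the classical smooth function that vanishes exactly on the nonpositive numbers. The
  factors \<open>inverse x ^ m\<close> are included because the derivative of such a function is a linear
  combination of two others, so smoothness of the whole family follows by induction.\<close>

definition flat :: "nat \<Rightarrow> real \<Rightarrow> real" where
  "flat m x = (if x > 0 then inverse x ^ m * exp (- inverse x) else 0)"

lemma flat_tendsto_0: "(flat m \<longlongrightarrow> 0) (at_right 0)"
proof -
  have "((\<lambda>x::real. inverse x ^ m / exp (inverse x)) \<longlongrightarrow> 0) (at_right 0)"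
    by (rule filterlim_compose[OF tendsto_power_div_exp_0 filterlim_inverse_at_top_right])
  then show ?thesis
    by (rule tendsto_cong[THEN iffD1, rotated])
      (auto simp: flat_def eventually_at_filter exp_minus divide_inverse)
qed

lemma has_derivative_flat:
  "(flat m has_real_derivative - real m * flat (m + 1) x + flat (m + 2) x) (at x)"
proof -
  consider "x > 0" | "x < 0" | "x = 0" by linarith
  then show ?thesis
  proof cases
    case 1
    have "((\<lambda>x. inverse x ^ m) has_real_derivative - real m * inverse x ^ (m + 1)) (at x)"
      using DERIV_power[OF DERIV_inverse[of x], of m] 1
      by (cases m) (simp_all add: power2_eq_square algebra_simps)
    moreover have "((\<lambda>x. exp (- inverse x)) has_real_derivative
        exp (- inverse x) * inverse x ^ 2) (at x)"
      using DERIV_fun_exp[OF DERIV_minus[OF DERIV_inverse[of x]]] 1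
      by (simp add: power2_eq_square)
    ultimately have "((\<lambda>x. inverse x ^ m * exp (- inverse x)) has_real_derivative
        - real m * inverse x ^ (m + 1) * exp (- inverse x)
        + exp (- inverse x) * inverse x ^ 2 * inverse x ^ m) (at x)"
      by (rule DERIV_mult)
    then have "((\<lambda>x. inverse x ^ m * exp (- inverse x)) has_real_derivative
        - real m * flat (m + 1) x + flat (m + 2) x) (at x)"
      using 1 by (simp add: flat_def power_add power2_eq_square mult_ac)
    moreover have "\<forall>\<^sub>F y in nhds x. flat m y = inverse y ^ m * exp (- inverse y)"
      using eventually_nhds_in_open[of "{0<..}" x] 1
      by (auto elim!: eventually_mono simp: flat_def)
    ultimately show ?thesis
      by (subst DERIV_cong_ev[OF refl _ refl]) 
  next
    case 2
    have "\<forall>\<^sub>F y in nhds x. flat m y = 0"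
      using eventually_nhds_in_open[of "{..<0}" x] 2
      by (auto elim!: eventually_mono simp: flat_def)
    then have "(flat m has_real_derivative 0) (at x)"
      by (subst DERIV_cong_ev[OF refl _ refl]) auto
    with 2 show ?thesis by (simp add: flat_def)
  next
    case 3
    \<comment> \<open>To the right of \<open>0\<close> the difference quotient is again a member of the family, \<open>flat (m + 1)\<close>.\<close>
    have "((\<lambda>h. (flat m (0 + h) - flat m 0) / h) \<longlongrightarrow> 0) (at 0)"
      unfolding filterlim_at_split
    proof
      show "((\<lambda>h. (flat m (0 + h) - flat m 0) / h) \<longlongrightarrow> 0) (at_left 0)"
        by (rule tendsto_eventually) (auto simp: flat_def eventually_at_filter)
      show "((\<lambda>h. (flat m (0 + h) - flat m 0) / h) \<longlongrightarrow> 0) (at_right 0)"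
        by (rule tendsto_cong[THEN iffD1, OF _ flat_tendsto_0[of "m + 1"]])
          (auto simp: flat_def eventually_at_filter divide_inverse)
    qed
    with 3 show ?thesis by (simp add: DERIV_def flat_def)
  qed
qed

lemma k_smooth_flat: "k_smooth k (flat m)"
proof (induction k arbitrary: m)
  case (Suc k)
  show ?case
    by (rule k_smooth_SucI[OF has_derivative_flat])
      (intro k_smooth_add k_smooth_mult k_smooth_const Suc.IH)
qed simp

definition smooth_step :: "real \<Rightarrow> real" where
  "smooth_step x = flat 0 x / (flat 0 x + flat 0 (1 - x))"

lemma flat_nonneg: "flat 0 x \<ge> 0"
  by (simp add: flat_def)

lemma flat_mono: "x \<le> y \<Longrightarrow> flat 0 x \<le> flat 0 y"
  by (auto simp: flat_def)

text \<open>One of \<open>x\<close> and \<open>1 - x\<close> is positive, which is what keeps the smooth step free of poles.\<close>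

lemma flat_denominator_pos: "flat 0 x + flat 0 (1 - x) > 0"
  by (auto simp: flat_def add_pos_pos)

lemma k_smooth_smooth_step: "k_smooth k smooth_step"
proof -
  have "k_smooth k (\<lambda>x. flat 0 x * inverse (flat 0 x + flat 0 ((-1) * x + 1)))"
    using flat_denominator_pos
    by (intro k_smooth_mult k_smooth_inverse k_smooth_add k_smooth_flat
        k_smooth_affine[where f = "flat 0" and a = "-1" and b = 1])
      (simp add: less_imp_neq[THEN not_sym])
  moreover have "smooth_step = (\<lambda>x. flat 0 x * inverse (flat 0 x + flat 0 ((-1) * x + 1)))"
    by (auto simp: smooth_step_def divide_inverse)
  ultimately show ?thesis by simp
qed

lemma smooth_step_0: "x \<le> 0 \<Longrightarrow> smooth_step x = 0"
  and smooth_step_1: "x \<ge> 1 \<Longrightarrow> smooth_step x = 1"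
  by (auto simp: smooth_step_def flat_def)

lemma smooth_step_mono: "mono smooth_step"
proof
  fix x y :: real
  assume "x \<le> y"
  then have "flat 0 x \<le> flat 0 y" "flat 0 (1 - y) \<le> flat 0 (1 - x)"
    by (auto intro: flat_mono)
  then have "flat 0 x * flat 0 (1 - y) \<le> flat 0 y * flat 0 (1 - x)"
    by (intro mult_mono) (auto simp: flat_nonneg)
  then show "smooth_step x \<le> smooth_step y"
    using flat_denominator_pos[of x] flat_denominator_pos[of y]
    by (simp add: smooth_step_def divide_simps) (simp add: algebra_simps)
qed

lemma smooth_step_bounds: "0 \<le> smooth_step x" "smooth_step x \<le> 1"
  using smooth_step_mono[THEN monoD, of "min x 0" x] smooth_step_mono[THEN monoD, of x "max x 1"]
  by (auto simp: smooth_step_0 smooth_step_1)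

lemma has_derivative_smooth_step: "(smooth_step has_real_derivative deriv smooth_step x) (at x)"
  using k_smooth_smooth_step[of "Suc 0"]
  by (rule k_smooth_SucE) (metis DERIV_imp_deriv)

lemma continuous_deriv_smooth_step: "continuous_on A (deriv smooth_step)"
  using k_smooth_higher_deriv[OF k_smooth_smooth_step, of 1]
  by (auto intro: continuous_on_subset differentiable_imp_continuous_on)

lemma deriv_smooth_step_nonneg: "deriv smooth_step x \<ge> 0"
  by (rule mono_on_imp_deriv_nonneg[OF _ has_derivative_smooth_step, of UNIV])
    (use smooth_step_mono in simp_all)

text \<open>Outside \<open>(0,1)\<close> the step takes its extreme values, so the derivative vanishes as at any
  extremum; this includes the two end points.\<close>

lemma deriv_smooth_step_0:
  assumes "x \<le> 0 \<or> x \<ge> 1"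
  shows "deriv smooth_step x = 0"
  using assms
proof
  assume "x \<le> 0"
  then show ?thesis
    using DERIV_local_min[OF has_derivative_smooth_step, of 1 x]
    by (simp add: smooth_step_0 smooth_step_bounds)
next
  assume "x \<ge> 1"
  then show ?thesis
    using DERIV_local_max[OF has_derivative_smooth_step, of 1 x]
    by (simp add: smooth_step_1 smooth_step_bounds)
qed

lemma DERIV_smooth_step_scaled:
  "((\<lambda>x. smooth_step (c * (x - r))) has_real_derivative c * deriv smooth_step (c * (x - r))) (at x)"
proof -
  have "((\<lambda>x. smooth_step (c * (x - r))) has_real_derivative
      deriv smooth_step (c * (x - r)) * c) (at x)"
    by (rule DERIV_chain2[OF has_derivative_smooth_step]) (auto intro!: derivative_eq_intros)
  then show ?thesis by (simp add: mult.commute)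
qed

lemma continuous_deriv_smooth_step_scaled:
  "continuous_on A (\<lambda>x. c * deriv smooth_step (c * (x - r)))"
  by (intro continuous_intros continuous_on_compose2[OF continuous_deriv_smooth_step[of UNIV]])
    auto

text \<open>The derivatives of \<open>smooth_step (n (x - r))\<close> are nonnegative, have total mass \<open>1\<close> and live on
  \<open>[r, r + 1/n]\<close>, so they concentrate at \<open>r\<close>.\<close>

lemma smooth_step_approximate_identity:
  fixes f :: "real \<Rightarrow> real"
  assumes f: "continuous_on {\<alpha>..\<beta>} f" and r: "\<alpha> < r" "r < \<beta>"
  shows "(\<lambda>n. integral {\<alpha>..\<beta>} (\<lambda>x. f x * (real n * deriv smooth_step (real n * (x - r)))))
           \<longlonglongrightarrow> f r"
proof (rule LIMSEQ_I)
  fix e :: real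
  assume "e > 0"
  then have "e / 2 > 0" and "r \<in> {\<alpha>..\<beta>}"
    using r by auto
  then obtain d where d: "d > 0" "\<And>x. x \<in> {\<alpha>..\<beta>} \<Longrightarrow> \<bar>x - r\<bar> < d \<Longrightarrow> \<bar>f x - f r\<bar> < e / 2"
    using f unfolding continuous_on_iff dist_real_def by blast
  obtain N where N: "real N > max (1 / d) (1 / (\<beta> - r))"
    using reals_Archimedean2 by blast
  show "\<exists>N. \<forall>n\<ge>N. norm (integral {\<alpha>..\<beta>}
      (\<lambda>x. f x * (real n * deriv smooth_step (real n * (x - r)))) - f r) < e"
  proof (intro exI allI impI)
    fix n
    assume "n \<ge> N"
    then have "real n \<ge> real N" by simp
    with N have "real n > 1 / d" "real n > 1 / (\<beta> - r)" by auto
    moreover from this d have n: "real n > 0"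
      using less_trans[of 0 "1 / d" "real n"] by simp
    ultimately have nd: "1 / real n < d" "real n * (\<beta> - r) \<ge> 1"
      using d r by (auto simp: field_simps)
    define p where "p x = real n * deriv smooth_step (real n * (x - r))" for x
    have p: "p x \<ge> 0" for x
      using deriv_smooth_step_nonneg by (simp add: p_def)
    \<comment> \<open>The mass lies within distance \<open>1 / n < d\<close> of \<open>r\<close>.\<close>
    have p0: "p x = 0" if "\<bar>x - r\<bar> \<ge> d" for x
    proof -
      have "1 < real n * d"
        using nd(1) n by (simp add: field_simps)
      also have "\<dots> \<le> real n * \<bar>x - r\<bar>"
        using that by (intro mult_left_mono) auto
      finally have "real n * \<bar>x - r\<bar> \<ge> 1"
        by simp
      then have "real n * (x - r) \<le> 0 \<or> real n * (x - r) \<ge> 1"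
        using n by (auto simp: abs_if mult_le_0_iff split: if_splits)
      then show ?thesis by (simp add: p_def deriv_smooth_step_0)
    qed
    have cp: "continuous_on {\<alpha>..\<beta>} p"
      unfolding p_def by (rule continuous_deriv_smooth_step_scaled)
    have "(p has_integral smooth_step (real n * (\<beta> - r)) - smooth_step (real n * (\<alpha> - r))) {\<alpha>..\<beta>}"
      using r unfolding p_def
      by (intro fundamental_theorem_of_calculus has_vector_derivative_at_within[OF
          DERIV_smooth_step_scaled[unfolded has_real_derivative_iff_has_vector_derivative]]) simp
    then have int_p: "(p has_integral 1) {\<alpha>..\<beta>}"
      using nd n r by (simp add: smooth_step_0 smooth_step_1 mult_le_0_iff)
    have "(\<lambda>x. f x * p x) integrable_on {\<alpha>..\<beta>}"
      by (intro integrable_continuous_real continuous_on_mult f cp)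
    then have diff: "((\<lambda>x. f x * p x - f r * p x) has_integral
        integral {\<alpha>..\<beta>} (\<lambda>x. f x * p x) - f r * 1) {\<alpha>..\<beta>}"
      by (intro has_integral_diff has_integral_mult_right int_p integrable_integral)
    have maj: "((\<lambda>x. e / 2 * p x) has_integral e / 2 * 1) {\<alpha>..\<beta>}"
      by (intro has_integral_mult_right int_p)
    have "norm (f x * p x - f r * p x) \<le> e / 2 * p x" if "x \<in> {\<alpha>..\<beta>}" for x
    proof (cases "\<bar>x - r\<bar> < d")
      case True
      have "norm (f x * p x - f r * p x) = \<bar>f x - f r\<bar> * p x"
        using p[of x] by (simp add: abs_mult flip: left_diff_distrib)
      also have "\<dots> \<le> e / 2 * p x"
        using d(2)[OF that True] p[of x] by (intro mult_right_mono) auto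
      finally show ?thesis .
    next
      case False
      with p0[of x] show ?thesis by simp
    qed
    then have "norm (integral {\<alpha>..\<beta>} (\<lambda>x. f x * p x) - f r * 1) \<le> e / 2 * 1"
      using integral_norm_bound_integral[OF has_integral_integrable[OF diff]
          has_integral_integrable[OF maj]]
      unfolding integral_unique[OF diff] integral_unique[OF maj] by blast
    then show "norm (integral {\<alpha>..\<beta>}
        (\<lambda>x. f x * (real n * deriv smooth_step (real n * (x - r)))) - f r) < e"
      using \<open>e > 0\<close> by (simp add: p_def)
  qed
qed

lemma smooth_step_tendsto_indicator:
  "(\<lambda>n. smooth_step (real n * (x - r))) \<longlonglongrightarrow> (if r < x then 1 else 0)"
proof (cases "r < x")
  case True
  obtain N where N: "real N > 1 / (x - r)"
    using reals_Archimedean2 by blast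
  have "smooth_step (real n * (x - r)) = 1" if "n \<ge> N" for n
  proof -
    have "real n \<ge> real N" using that by simp
    with N have "real n > 1 / (x - r)" by simp
    with True show ?thesis by (intro smooth_step_1) (simp add: field_simps)
  qed
  with True show ?thesis
    by (auto intro!: tendsto_eventually eventually_sequentiallyI)
next
  case False
  then show ?thesis by (simp add: smooth_step_0 mult_le_0_iff)
qed

section \<open>The fundamental theorem of calculus for weak derivatives\<close>

text \<open>Bridges the Lebesgue integral in the definition of weak derivatives, taken over an open interval on
  which the representative need not be integrable, and the gauge integral over a compact
  interval that contains the support.\<close>

lemma LINT_lebesgue_on_supported:
  fixes f :: "real \<Rightarrow> real"
  assumes f: "f absolutely_integrable_on J" and "J \<subseteq> S" "S \<in> sets lebesgue"
    and "\<And>x. x \<notin> J \<Longrightarrow> f x = 0"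
  shows "(LINT x|lebesgue_on S. f x) = integral J f"
proof -
  have "(LINT x|lebesgue_on S. f x) = (LINT x|lebesgue. indicator S x *\<^sub>R f x)"
    using assms by (simp add: integral_restrict_space)
  also have "\<dots> = (LINT x|lebesgue. indicator J x *\<^sub>R f x)"
    using assms by (intro Bochner_Integration.integral_cong) (auto simp: indicator_def)
  also have "\<dots> = integral J f"
    using set_lebesgue_integral_eq_integral(2)[OF f] by (simp add: set_lebesgue_integral_def)
  finally show ?thesis .
qed

text \<open>Test the weak derivative with \<open>\<phi>\<^sub>n\<close>, a difference of two scaled steps at \<open>s\<close> and \<open>t\<close>. As \<open>n\<close> grows,
  \<open>\<integral>g \<phi>\<^sub>n\<close> tends to the integral of \<open>g\<close> over \<open>[s,t]\<close> by dominated convergence, while \<open>\<integral>\<theta> \<phi>\<^sub>n'\<close> tends to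
  \<open>\<theta> s - \<theta> t\<close>.\<close>

lemma weak_derivative_FTC_interior:
  assumes \<theta>: "continuous_on {0..l} \<theta>" and g: "has_weak_deriv l \<theta> g"
    and st: "0 < s" "s < t" "t < l"
  shows "(g has_integral (\<theta> t - \<theta> s)) {s..t}"
proof -
  \<comment> \<open>A compact subinterval of \<open>(0,l)\<close>, with room to the right of \<open>t\<close> for the tail of \<open>\<phi> n\<close>.\<close>
  define \<alpha> where "\<alpha> = s / 2"
  define \<beta> where "\<beta> = (t + l) / 2"
  have ab: "0 < \<alpha>" "\<alpha> < s" "t < \<beta>" "\<beta> < l"
    using st by (auto simp: \<alpha>_def \<beta>_def)
  define \<phi> where "\<phi> n x = smooth_step (real n * (x - s)) - smooth_step (real n * (x - t))" for n x
  define \<phi>' where "\<phi>' n x = real n * deriv smooth_step (real n * (x - s)) -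
      real n * deriv smooth_step (real n * (x - t))" for n x
  have D\<phi>: "(\<phi> n has_real_derivative \<phi>' n x) (at x)" for n x
    unfolding \<phi>_def \<phi>'_def by (intro DERIV_diff DERIV_smooth_step_scaled)
  have D\<phi>': "deriv (\<phi> n) x = \<phi>' n x" for n x
    by (rule DERIV_imp_deriv[OF D\<phi>])
  have c\<phi>: "continuous_on A (\<phi> n)" for n A
    using D\<phi> by (meson DERIV_isCont continuous_at_imp_continuous_on)
  have \<phi>1: "\<bar>\<phi> n x\<bar> \<le> 1" for n x
    using smooth_step_bounds[of "real n * (x - s)"] smooth_step_bounds[of "real n * (x - t)"]
    by (simp add: \<phi>_def)
  have g_int: "g absolutely_integrable_on {c..d}" if "0 < c" "d < l" for c d
    using g that by (auto simp: has_weak_deriv_def locally_integrable_def)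
  have \<theta>_cont: "continuous_on {\<alpha>..\<beta>} \<theta>"
    using ab by (intro continuous_on_subset[OF \<theta>]) auto
  have g\<phi>: "(\<lambda>x. \<phi> n x * g x) absolutely_integrable_on {\<alpha>..\<beta>}" for n
    using ab
    by (intro absolutely_integrable_bounded_measurable_product_real g_int
        continuous_imp_measurable_on_sets_lebesgue c\<phi> compact_imp_bounded
        compact_continuous_image) auto
  have \<theta>\<phi>': "(\<lambda>x. \<theta> x * \<phi>' n x) absolutely_integrable_on {\<alpha>..\<beta>}" for n
    unfolding \<phi>'_def
    by (intro absolutely_integrable_continuous_real continuous_on_mult \<theta>_cont
        continuous_on_diff continuous_deriv_smooth_step_scaled)
  obtain N where N: "real N > 1 / (\<beta> - t)"
    using reals_Archimedean2 by blast
  have key: "integral {\<alpha>..\<beta>} (\<lambda>x. \<theta> x * \<phi>' n x) = - integral {\<alpha>..\<beta>} (\<lambda>x. \<phi> n x * g x)"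
    if "n \<ge> N" for n
  proof -
    have "real n \<ge> real N" using that by simp
    with N have "real n > 1 / (\<beta> - t)" by simp
    moreover from this ab have n: "real n > 0"
      using less_trans[of 0 "1 / (\<beta> - t)" "real n"] by simp
    ultimately have n\<beta>: "real n * (\<beta> - t) \<ge> 1"
      using ab by (simp add: field_simps)
    have left: "real n * (x - s) \<le> 0" "real n * (x - t) \<le> 0" if "x < s" for x
      using n that st by (auto simp: mult_le_0_iff)
    have right: "real n * (x - s) \<ge> 1" "real n * (x - t) \<ge> 1" if "x > \<beta>" for x
    proof -
      have "real n * (\<beta> - t) \<le> real n * (x - t)" "real n * (\<beta> - t) \<le> real n * (x - s)"
        using n that st by (auto intro!: mult_left_mono)
      with n\<beta> show "real n * (x - s) \<ge> 1" "real n * (x - t) \<ge> 1" by auto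
    qed
    have \<phi>0: "\<phi> n x = 0" "\<phi>' n x = 0" if "x \<notin> {s..\<beta>}" for x
      using left[of x] right[of x] that
      by (auto simp: \<phi>_def \<phi>'_def smooth_step_0 smooth_step_1 deriv_smooth_step_0 not_le)
    have cl: "closure {x. \<phi> n x \<noteq> 0} \<subseteq> {s..\<beta>}"
      using \<phi>0(1) by (intro closure_minimal closed_atLeastAtMost) blast
    have "k_smooth k (\<phi> n)" for k
    proof -
      have "k_smooth k (\<lambda>x. smooth_step (real n * x + - real n * s) -
          smooth_step (real n * x + - real n * t))"
        by (rule k_smooth_diff; rule k_smooth_affine; rule k_smooth_smooth_step)
      then show ?thesis by (simp add: \<phi>_def[abs_def] algebra_simps)
    qed
    then have "((deriv ^^ k) (\<phi> n)) differentiable_on UNIV" for k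
      by (rule k_smooth_higher_deriv)
    moreover have "compact (closure {x. \<phi> n x \<noteq> 0})"
      using cl by (meson bounded_closed_interval bounded_subset closed_closure compact_eq_bounded_closed)
    moreover have "closure {x. \<phi> n x \<noteq> 0} \<subseteq> {0<..<l}"
      using cl st ab by force
    ultimately have "test_function l (\<phi> n)"
      by (simp add: test_function_def)
    then have "(LINT x|lebesgue_on {0<..<l}. \<theta> x * deriv (\<phi> n) x) =
        - (LINT x|lebesgue_on {0<..<l}. g x * \<phi> n x)"
      using g unfolding has_weak_deriv_def by blast
    then have "(LINT x|lebesgue_on {0<..<l}. \<theta> x * \<phi>' n x) =
        - (LINT x|lebesgue_on {0<..<l}. \<phi> n x * g x)"
      by (simp only: D\<phi>' mult.commute[of "g _"])
    moreover have "(LINT x|lebesgue_on {0<..<l}. \<theta> x * \<phi>' n x) =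
        integral {\<alpha>..\<beta>} (\<lambda>x. \<theta> x * \<phi>' n x)"
      using ab \<phi>0 st by (intro LINT_lebesgue_on_supported[OF \<theta>\<phi>']) auto
    moreover have "(LINT x|lebesgue_on {0<..<l}. \<phi> n x * g x) =
        integral {\<alpha>..\<beta>} (\<lambda>x. \<phi> n x * g x)"
      using ab \<phi>0 st by (intro LINT_lebesgue_on_supported[OF g\<phi>]) auto
    ultimately show ?thesis by simp
  qed
  have "(\<lambda>n. integral {\<alpha>..\<beta>} (\<lambda>x. \<theta> x * (real n * deriv smooth_step (real n * (x - s)))) -
      integral {\<alpha>..\<beta>} (\<lambda>x. \<theta> x * (real n * deriv smooth_step (real n * (x - t)))))
      \<longlonglongrightarrow> \<theta> s - \<theta> t"
    using ab st by (intro tendsto_diff smooth_step_approximate_identity \<theta>_cont) auto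
  moreover have "integral {\<alpha>..\<beta>} (\<lambda>x. \<theta> x * \<phi>' n x) =
      integral {\<alpha>..\<beta>} (\<lambda>x. \<theta> x * (real n * deriv smooth_step (real n * (x - s)))) -
      integral {\<alpha>..\<beta>} (\<lambda>x. \<theta> x * (real n * deriv smooth_step (real n * (x - t))))" for n
    unfolding \<phi>'_def right_diff_distrib[of "\<theta> _"]
    by (intro Henstock_Kurzweil_Integration.integral_diff integrable_continuous_real
        continuous_on_mult \<theta>_cont continuous_deriv_smooth_step_scaled)
  ultimately have lim1: "(\<lambda>n. integral {\<alpha>..\<beta>} (\<lambda>x. \<theta> x * \<phi>' n x)) \<longlonglongrightarrow> \<theta> s - \<theta> t"
    by simp
  have "(\<lambda>n. integral {\<alpha>..\<beta>} (\<lambda>x. \<phi> n x * g x)) \<longlonglongrightarrow>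
      integral {\<alpha>..\<beta>} (\<lambda>x. if x \<in> {s<..t} then g x else 0)"
  proof (rule dominated_convergence(2))
    show "(\<lambda>x. \<phi> n x * g x) integrable_on {\<alpha>..\<beta>}" for n
      using g\<phi> set_lebesgue_integral_eq_integral(1) by blast
    show "(\<lambda>x. \<bar>g x\<bar>) integrable_on {\<alpha>..\<beta>}"
      using g_int[of \<alpha> \<beta>] ab by (simp add: absolutely_integrable_on_def)
    show "norm (\<phi> n x * g x) \<le> \<bar>g x\<bar>" for n x
      using \<phi>1[of n x] by (simp add: abs_mult mult_left_le_one_le)
    show "(\<lambda>n. \<phi> n x * g x) \<longlonglongrightarrow> (if x \<in> {s<..t} then g x else 0)" for x
    proof -
      have "(\<lambda>n. \<phi> n x * g x) \<longlonglongrightarrow>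
          ((if s < x then 1 else 0) - (if t < x then 1 else 0)) * g x"
        unfolding \<phi>_def by (intro tendsto_intros smooth_step_tendsto_indicator)
      moreover have "((if s < x then 1 else 0) - (if t < x then 1 else 0)) * g x =
          (if x \<in> {s<..t} then g x else 0)"
        using st by auto
      ultimately show ?thesis by simp
    qed
  qed
  also have "integral {\<alpha>..\<beta>} (\<lambda>x. if x \<in> {s<..t} then g x else 0) = integral {s<..t} g"
    using ab by (simp only: integral_restrict_Int) (rule arg_cong2[where f = integral]; auto)
  also have "\<dots> = integral {s..t} g"
    by (rule integral_spike_set) (auto intro: negligible_subset[of "{s}"])
  finally have lim2: "(\<lambda>n. - integral {\<alpha>..\<beta>} (\<lambda>x. \<phi> n x * g x)) \<longlonglongrightarrow> - integral {s..t} g"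
    by (rule tendsto_minus)
  have "(\<lambda>n. integral {\<alpha>..\<beta>} (\<lambda>x. \<theta> x * \<phi>' n x)) \<longlonglongrightarrow> - integral {s..t} g"
    by (rule Lim_transform_eventually[OF lim2 eventually_sequentiallyI[of N]]) (simp add: key)
  with lim1 have "\<theta> s - \<theta> t = - integral {s..t} g"
    by (rule LIMSEQ_unique)
  moreover have "g integrable_on {s..t}"
    using g_int[of s t] st set_lebesgue_integral_eq_integral(1) by auto
  ultimately show ?thesis
    by (simp add: has_integral_iff)
qed

text \<open>Every integral of \<open>g\<close> over a compact subinterval of \<open>(0,l)\<close> vanishes, hence so do its averages,
  and these converge to \<open>g\<close> almost everywhere by Lebesgue differentiation. The differentiation
  theorem wants a function that is integrable on every interval, so \<open>g\<close> is first cut off to a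
  compact subinterval, and the exceptional sets are combined by locality of negligibility.\<close>

lemma weak_deriv_of_zero_AE:
  assumes g: "has_weak_deriv l (\<lambda>_. 0) g"
  shows "AE x in lebesgue_on {0..l}. g x = 0"
proof -
  have local: "negligible {x \<in> {s<..<t}. g x \<noteq> 0}" if st: "0 < s" "t < l" for s t
  proof -
    define F where "F x = (if x \<in> {s<..<t} then g x else 0)" for x
    have "g absolutely_integrable_on {s..t}"
      using g st by (auto simp: has_weak_deriv_def locally_integrable_def)
    then have "g absolutely_integrable_on ({s<..<t} \<inter> cbox a b)" for a b
      by (rule set_integrable_subset) auto
    then have "F integrable_on cbox a b" for a b
      unfolding F_def integrable_restrict_Int
      using set_lebesgue_integral_eq_integral(1) by blast
    then obtain N where N: "negligible N"
      "\<And>x e. \<lbrakk>x \<notin> N; 0 < e\<rbrakk> \<Longrightarrow> \<exists>d>0. \<forall>h. 0 < h \<and> h < d \<longrightarrow>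
         norm (integral (cbox x (x + h *\<^sub>R One)) F /\<^sub>R h ^ DIM(real) - F x) < e"
      by (rule integrable_ccontinuous_explicit) blast
    have "g x = 0" if x: "x \<in> {s<..<t}" "x \<notin> N" for x
    proof (rule ccontr)
      assume "g x \<noteq> 0"
      then obtain d where d: "d > 0" "\<And>h. 0 < h \<Longrightarrow> h < d \<Longrightarrow>
          \<bar>integral {x..x + h} F / h - F x\<bar> < \<bar>g x\<bar>"
        using N(2)[of x "\<bar>g x\<bar>"] x by (auto simp: divide_inverse mult.commute)
      define h where "h = min d (t - x) / 2"
      have h: "0 < h" "h < d" "x + h < t"
        using d x by (auto simp: h_def min_def field_simps)
      have "integral {x..x + h} F = integral {x..x + h} g"
        using h x by (intro integral_cong) (auto simp: F_def)
      also have "\<dots> = 0"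
        using weak_derivative_FTC_interior[OF _ g, of x "x + h"] h x st
        by (auto simp: has_integral_iff)
      finally show False
        using d(2)[OF h(1,2)] x by (simp add: F_def)
    qed
    then show ?thesis
      by (intro negligible_subset[OF N(1)]) auto
  qed
  have "negligible {x \<in> {0<..<l}. g x \<noteq> 0}"
    unfolding locally_negligible_alt[of "{x \<in> {0<..<l}. g x \<noteq> 0}"]
  proof
    fix x
    assume x: "x \<in> {x \<in> {0<..<l}. g x \<noteq> 0}"
    let ?U = "{y \<in> {x / 2<..<(x + l) / 2}. g y \<noteq> 0}"
    have "openin (top_of_set {x \<in> {0<..<l}. g x \<noteq> 0})
        ({x \<in> {0<..<l}. g x \<noteq> 0} \<inter> {x / 2<..<(x + l) / 2})"
      by (simp add: openin_open_Int)
    moreover have "{x \<in> {0<..<l}. g x \<noteq> 0} \<inter> {x / 2<..<(x + l) / 2} = ?U"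
      using x by auto
    moreover have "x \<in> ?U"
      using x by auto
    moreover have "negligible ?U"
      using x by (intro local) auto
    ultimately show "\<exists>U. openin (top_of_set {x \<in> {0<..<l}. g x \<noteq> 0}) U \<and> x \<in> U \<and> negligible U"
      by (intro exI[of _ ?U]) simp
  qed
  then have "negligible ({x \<in> {0<..<l}. g x \<noteq> 0} \<union> {0, l})"
    by (rule negligible_Un) simp
  then have "negligible {x \<in> {0..l}. g x \<noteq> 0}"
    by (rule negligible_subset) auto
  then show ?thesis
    by (intro AE_I'[of "{x \<in> {0..l}. g x \<noteq> 0}"])
      (auto simp: null_sets_restrict_space negligible_iff_null_sets)
qed

text \<open>The difference of \<open>\<theta>\<close> and the indefinite integral of \<open>g\<close> is constant on \<open>(0,l)\<close> and continuous on
  \<open>[0,l]\<close>.\<close>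

lemma weak_derivative_FTC:
  assumes \<theta>: "continuous_on {0..l} \<theta>" and g: "has_weak_deriv l \<theta> g"
    and gi: "g integrable_on {0..l}"
    and st: "0 \<le> s" "s \<le> t" "t \<le> l"
  shows "(g has_integral (\<theta> t - \<theta> s)) {s..t}"
proof -
  have sub: "g integrable_on {c..d}" if "0 \<le> c" "d \<le> l" for c d
    by (rule integrable_subinterval_real[OF gi]) (use that in auto)
  define F where "F t = integral {0..t} g" for t
  have F: "F t - F s = integral {s..t} g" if "0 \<le> s" "s \<le> t" "t \<le> l" for s t
    using Henstock_Kurzweil_Integration.integral_combine[of 0 s t g] that sub[of 0 t]
    by (simp add: F_def)
  show ?thesis
  proof (cases "l > 0")
    case True
    have cont: "continuous_on (closure {0<..<l}) (\<lambda>t. \<theta> t - F t)"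
      using True unfolding F_def
      by (simp add: closure_greaterThanLessThan)
        (intro continuous_on_diff \<theta> indefinite_integral_continuous_1 gi)
    have const: "\<theta> x - F x = \<theta> y - F y" if "0 < x" "x < y" "y < l" for x y
    proof -
      have "integral {x..y} g = \<theta> y - \<theta> x"
        by (rule integral_unique[OF weak_derivative_FTC_interior[OF \<theta> g that]])
      moreover have "F y - F x = integral {x..y} g"
        using that by (intro F) auto
      ultimately show ?thesis by linarith
    qed
    have "\<theta> x - F x = \<theta> (l / 2) - F (l / 2)" if "x \<in> {0<..<l}" for x
    proof (cases x "l / 2" rule: linorder_cases)
      case less
      with that show ?thesis by (intro const) auto
    next
      case greater
      with that show ?thesis by (intro const[symmetric]) auto
    qed (simp only:)
    then have *: "\<theta> x - F x = \<theta> (l / 2) - F (l / 2)" if "x \<in> closure {0<..<l}" for x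
      using that by (rule continuous_constant_on_closure[OF cont])
    have "s \<in> closure {0<..<l}" "t \<in> closure {0<..<l}"
      using st True by (auto simp: closure_greaterThanLessThan)
    from *[OF this(1)] *[OF this(2)] F[OF st] have "integral {s..t} g = \<theta> t - \<theta> s"
      by linarith
    with sub[of s t] st show ?thesis
      by (simp add: has_integral_iff)
  next
    case False
    with st have "t = s" by simp
    then show ?thesis by (simp add: has_integral_refl)
  qed
qed

section \<open>Finiteness of the energy and its consequences\<close>

lemma has_weak_deriv_weak_deriv:
  "has_weak_deriv l \<theta> g \<Longrightarrow> has_weak_deriv l \<theta> (weak_deriv l \<theta>)"
  unfolding weak_deriv_def by (rule someI[of "has_weak_deriv l \<theta>"])

text \<open>At \<open>\<theta> = 0\<close> the denominator of the density is \<open>\<kappa>\<^sup>2\<close>, which is bounded away from \<open>0\<close>.\<close>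

lemma energy_of_zero_finite:
  assumes "continuous_on {0..l} \<kappa>" "\<And>t. t \<in> {0..l} \<Longrightarrow> \<kappa> t > 0" "continuous_on {0..l} \<tau>"
  shows "(\<lambda>_. 0) \<in> W14 l" and "energy l \<kappa> \<tau> (\<lambda>_. 0) < \<infinity>"
proof -
  have wd: "has_weak_deriv l (\<lambda>_. 0) (\<lambda>_. 0)"
    by (simp add: has_weak_deriv_def locally_integrable_def)
  have "in_L4 l (\<lambda>_. 0)"
    by (simp add: in_L4_def)
  with wd show "(\<lambda>_. 0) \<in> W14 l"
    by (auto simp: W14_def)
  let ?f = "\<lambda>t. (\<kappa> t ^ 2 + \<tau> t ^ 2) ^ 2 / \<kappa> t ^ 2"
  have AE0: "AE t in lebesgue_on {0..l}. weak_deriv l (\<lambda>_. 0) t = 0"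
    by (rule weak_deriv_of_zero_AE[OF has_weak_deriv_weak_deriv[OF wd]])
  have AE_S: "AE t in lebesgue_on {0..l}. t \<in> {0..l}"
    using AE_space[of "lebesgue_on {0..l}"] by simp
  have "energy l \<kappa> \<tau> (\<lambda>_. 0) = (\<integral>\<^sup>+ t. ennreal (norm (?f t)) \<partial>lebesgue_on {0..l})"
    unfolding energy_def
  proof (rule nn_integral_cong_AE, use AE0 AE_S in eventually_elim)
    case (elim t)
    with assms(2)[of t] show ?case
      by (simp add: energy_density_def divide_ennreal)
  qed
  moreover have "integrable (lebesgue_on {0..l}) ?f"
  proof -
    have "\<kappa> t ^ 2 \<noteq> 0" if "t \<in> {0..l}" for t
      using assms(2)[OF that] by simp
    then show ?thesis
      by (intro continuous_imp_integrable_real continuous_intros assms) blast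
  qed
  ultimately show "energy l \<kappa> \<tau> (\<lambda>_. 0) < \<infinity>"
    by (simp add: integrable_iff_bounded)
qed

text \<open>When the denominator vanishes, the right-hand side is infinite unless \<open>v + s = 0\<close>, in which case
  the left-hand side is \<open>0\<close>.\<close>

lemma energy_density_ge:
  assumes "0 < k" "k \<le> K" "\<bar>cos x\<bar> \<le> C" "0 < C"
  shows "ennreal ((v + s) ^ 4 / (K\<^sup>2 * C\<^sup>2)) \<le> energy_density k s x v"
proof (cases "cos x = 0")
  case True
  then show ?thesis
    by (cases "v + s = 0") (simp_all add: energy_density_zero_zero energy_density_nonzero_zero)
next
  case False
  have "(cos x)\<^sup>2 \<le> C\<^sup>2"
    using assms by (simp add: abs_le_square_iff[symmetric])
  moreover have "k\<^sup>2 \<le> K\<^sup>2"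
    using assms by (intro power_mono) auto
  ultimately have den: "k\<^sup>2 * (cos x)\<^sup>2 \<le> K\<^sup>2 * C\<^sup>2"
    by (intro mult_mono) auto
  have pos: "k\<^sup>2 * (cos x)\<^sup>2 > 0"
    using False assms by simp
  have "(v + s) ^ 4 = ((v + s)\<^sup>2)\<^sup>2"
    by simp
  also have "\<dots> \<le> (k\<^sup>2 * (cos x)\<^sup>2 + (v + s)\<^sup>2)\<^sup>2"
    by (intro power_mono) auto
  finally have "(v + s) ^ 4 / (K\<^sup>2 * C\<^sup>2) \<le>
      (k\<^sup>2 * (cos x)\<^sup>2 + (v + s)\<^sup>2)\<^sup>2 / (k\<^sup>2 * (cos x)\<^sup>2)"
    using den pos by (intro frac_le) auto
  then show ?thesis
    using pos by (simp add: energy_density_def divide_ennreal ennreal_leI)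
qed

text \<open>The function is the pointwise limit of its restrictions to compact intervals exhausting \<open>(0,l)\<close>.\<close>

lemma locally_integrable_imp_borel_measurable:
  assumes "locally_integrable l g"
  shows "g \<in> borel_measurable (lebesgue_on {0<..<l})"
proof (rule borel_measurable_LIMSEQ_real)
  define J where "J n = {inverse (Suc n)..l - inverse (Suc n)}" for n :: nat
  show "(\<lambda>x. if x \<in> J n then g x else 0) \<in> borel_measurable (lebesgue_on {0<..<l})" for n
  proof (subst borel_measurable_if_lebesgue_on)
    have "0 < inverse (real (Suc n))"
      by (simp del: of_nat_Suc)
    then show "J n \<subseteq> {0<..<l}"
      unfolding J_def
      by (intro subsetI) (unfold atLeastAtMost_iff greaterThanLessThan_iff, linarith)
    have "g absolutely_integrable_on J n"
      using assms unfolding locally_integrable_def J_def by simp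
    then show "g \<in> borel_measurable (lebesgue_on (J n))"
      by (rule absolutely_integrable_imp_borel_measurable) (simp add: J_def)
  qed (auto simp: J_def)
  fix x
  assume "x \<in> space (lebesgue_on {0<..<l})"
  then have "x > 0" "l - x > 0" by auto
  then have "\<forall>\<^sub>F n in sequentially. inverse (real (Suc n)) < x"
    "\<forall>\<^sub>F n in sequentially. inverse (real (Suc n)) < l - x"
    using order_tendstoD(2)[OF LIMSEQ_inverse_real_of_nat] by auto
  then have "\<forall>\<^sub>F n in sequentially. (if x \<in> J n then g x else 0) = g x"
    by eventually_elim (auto simp: J_def)
  then show "(\<lambda>n. if x \<in> J n then g x else 0) \<longlonglongrightarrow> g x"
    by (rule tendsto_eventually)
qed

lemma absolutely_integrable_on_Icc_iff_Ioo:
  fixes f :: "real \<Rightarrow> real"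
  shows "f absolutely_integrable_on {a..b} \<longleftrightarrow> f absolutely_integrable_on {a<..<b}"
  unfolding absolutely_integrable_on_def by (simp only: integrable_on_Icc_iff_Ioo)

lemma abs_le_one_plus_power4: "\<bar>x\<bar> \<le> 1 + x ^ 4" for x :: real
proof (cases "\<bar>x\<bar> \<le> 1")
  case False
  then have "\<bar>x\<bar> ^ 1 \<le> \<bar>x\<bar> ^ 4"
    by (intro power_increasing) auto
  then show ?thesis by simp
qed (simp add: add_increasing2)

text \<open>As \<open>\<bar>cos\<bar> \<le> 1\<close>, the energy controls the integral of \<open>(\<theta>' + \<tau>)\<^sup>4\<close>. This yields integrability up to the
  end points for the chosen representative of the weak derivative, whose defining property is
  local in \<open>(0,l)\<close>.\<close>

lemma finite_energy_absolutely_integrable: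
  assumes \<tau>: "continuous_on {0..l} \<tau>"
    and \<kappa>: "\<And>t. t \<in> {0..l} \<Longrightarrow> 0 < \<kappa> t \<and> \<kappa> t \<le> K" and "K > 0"
    and wd: "has_weak_deriv l \<theta> g"
    and fin: "energy l \<kappa> \<tau> \<theta> < \<infinity>"
  shows "(\<lambda>t. weak_deriv l \<theta> t + \<tau> t) absolutely_integrable_on {0..l}"
proof -
  define w where "w t = weak_deriv l \<theta> t + \<tau> t" for t
  have "weak_deriv l \<theta> \<in> borel_measurable (lebesgue_on {0<..<l})"
    using has_weak_deriv_weak_deriv[OF wd]
    by (intro locally_integrable_imp_borel_measurable) (simp add: has_weak_deriv_def)
  moreover have "\<tau> \<in> borel_measurable (lebesgue_on {0<..<l})"
    by (intro continuous_imp_measurable_on_sets_lebesgue continuous_on_subset[OF \<tau>]) auto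
  ultimately have w: "w \<in> borel_measurable (lebesgue_on {0<..<l})"
    unfolding w_def by (rule borel_measurable_add)
  have "(\<integral>\<^sup>+ t. ennreal (norm (w t ^ 4 / K\<^sup>2)) \<partial>lebesgue_on {0<..<l}) \<le>
      (\<integral>\<^sup>+ t. energy_density (\<kappa> t) (\<tau> t) (\<theta> t) (weak_deriv l \<theta> t) \<partial>lebesgue_on {0<..<l})"
    using energy_density_ge[where C = 1] \<kappa> by (intro nn_integral_mono) (simp add: w_def)
  also have "\<dots> \<le> energy l \<kappa> \<tau> \<theta>"
    unfolding energy_def
    by (subst (1 2) nn_integral_restrict_space)
      (auto intro!: nn_integral_mono simp: indicator_def)
  finally have "(\<integral>\<^sup>+ t. ennreal (norm (w t ^ 4 / K\<^sup>2)) \<partial>lebesgue_on {0<..<l}) < \<infinity>"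
    using fin by (rule le_less_trans)
  then have "integrable (lebesgue_on {0<..<l}) (\<lambda>t. w t ^ 4 / K\<^sup>2)"
    using w by (intro integrableI_bounded) simp_all
  then have "integrable (lebesgue_on {0<..<l}) (\<lambda>t. K\<^sup>2 * (w t ^ 4 / K\<^sup>2))"
    by (rule Bochner_Integration.integrable_mult_right)
  moreover have "(\<lambda>t. K\<^sup>2 * (w t ^ 4 / K\<^sup>2)) = (\<lambda>t. w t ^ 4)"
    using \<open>K > 0\<close> by simp
  ultimately have "integrable (lebesgue_on {0<..<l}) (\<lambda>t. w t ^ 4)"
    by (simp only:)
  then have "(\<lambda>t. w t ^ 4) integrable_on {0<..<l}"
    by (rule integrable_on_lebesgue_on) simp
  then have "(\<lambda>t. 1 + w t ^ 4) integrable_on {0<..<l}"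
    by (intro Henstock_Kurzweil_Integration.integrable_add)
      (simp_all add: integrable_const_ivl flip: integrable_on_Icc_iff_Ioo)
  then have "w absolutely_integrable_on {0<..<l}"
    by (intro measurable_bounded_by_integrable_imp_absolutely_integrable[OF w])
      (auto simp: abs_le_one_plus_power4)
  then show ?thesis
    by (simp add: absolutely_integrable_on_Icc_iff_Ioo w_def[abs_def])
qed

section \<open>Nearby singular points cost energy\<close>

lemma abs_cos_diff_le: "\<bar>cos x - cos y\<bar> \<le> \<bar>x - y\<bar>" for x y :: real
proof -
  have "norm (cos x - cos y) \<le> 1 * norm (x - y)"
    by (rule field_differentiable_bound[of UNIV cos "\<lambda>x. - sin x"])
      (auto intro!: derivative_eq_intros)
  then show ?thesis by simp
qed

text \<open>By convexity the graph of \<open>y\<^sup>4\<close> lies above its tangent at \<open>m\<close>; here \<open>y = \<bar>x\<bar>\<close>. Integrated with \<open>m\<close> equal to the mean of \<open>\<bar>x\<bar>\<close>,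
  this gives the power mean inequality.\<close>

lemma power4_above_tangent: "4 * m ^ 3 * \<bar>x\<bar> - 3 * m ^ 4 \<le> x ^ 4" for m x :: real
proof -
  have "x ^ 4 - (4 * m ^ 3 * \<bar>x\<bar> - 3 * m ^ 4) =
      (\<bar>x\<bar> - m)\<^sup>2 * ((\<bar>x\<bar> + m)\<^sup>2 + 2 * m\<^sup>2)"
    by (simp add: power2_eq_square power3_eq_cube power4_eq_xxxx algebra_simps abs_mult_self_eq)
  also have "\<dots> \<ge> 0" by simp
  finally show ?thesis by simp
qed

lemma ennreal_integral_le_nn_integral:
  assumes "integrable M f"
  shows "ennreal (integral\<^sup>L M f) \<le> (\<integral>\<^sup>+ x. ennreal (f x) \<partial>M)"
proof -
  have "integral\<^sup>L M f \<le> (LINT x|M. max 0 (f x))"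
    using assms by (intro integral_mono) auto
  then have "ennreal (integral\<^sup>L M f) \<le> ennreal (LINT x|M. max 0 (f x))"
    by (rule ennreal_leI)
  also have "\<dots> = (\<integral>\<^sup>+ x. ennreal (max 0 (f x)) \<partial>M)"
    using assms by (intro nn_integral_eq_integral[symmetric]) auto
  also have "\<dots> = (\<integral>\<^sup>+ x. ennreal (f x) \<partial>M)"
    by (simp add: ennreal_max_0)
  finally show ?thesis .
qed

text \<open>The sign \<open>\<sigma>\<close> of the torsion lets one argument serve both orientations.\<close>

lemma singular_points_gap:
  fixes \<sigma> c :: real
  assumes ab: "a < b"
    and w: "w absolutely_integrable_on {a..b}" and \<tau>: "continuous_on {a..b} \<tau>"
    and FTC: "\<And>s t. a \<le> s \<Longrightarrow> s \<le> t \<Longrightarrow> t \<le> b \<Longrightarrow>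
        ((\<lambda>x. w x - \<tau> x) has_integral (\<theta> t - \<theta> s)) {s..t}"
    and \<sigma>: "\<bar>\<sigma>\<bar> = 1" and c: "c > 0" "\<And>t. t \<in> {a..b} \<Longrightarrow> \<sigma> * \<tau> t \<ge> c"
    and sing: "cos (\<theta> a) = 0" "\<theta> b = \<theta> a"
    and \<kappa>: "\<And>t. t \<in> {a..b} \<Longrightarrow> 0 < \<kappa> t \<and> \<kappa> t \<le> K"
    and E: "(\<integral>\<^sup>+ t. energy_density (\<kappa> t) (\<tau> t) (\<theta> t) (w t - \<tau> t) \<partial>lebesgue_on {a..b}) \<le> ennreal E"
      "E \<ge> 0"
  shows "c\<^sup>2 \<le> (b - a) * K\<^sup>2 * E"
proof -
  define S where "S = integral {a..b} (\<lambda>x. \<bar>w x\<bar>)"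
  define h where "h = b - a"
  have K: "K > 0"
    using \<kappa>[of a] ab by auto
  have absw: "(\<lambda>x. \<bar>w x\<bar>) integrable_on {a..b}" and wi: "w integrable_on {a..b}"
    using w by (auto simp: absolutely_integrable_on_def)
  have wi': "w integrable_on {s..t}" and absw': "(\<lambda>x. \<bar>w x\<bar>) integrable_on {s..t}"
    and \<tau>i: "\<tau> integrable_on {s..t}" if "a \<le> s" "t \<le> b" for s t
  proof -
    have "{s..t} \<subseteq> {a..b}"
      using that by auto
    then show "w integrable_on {s..t}" "(\<lambda>x. \<bar>w x\<bar>) integrable_on {s..t}" "\<tau> integrable_on {s..t}"
      by (rule integrable_subinterval_real[OF wi] integrable_subinterval_real[OF absw]
          integrable_continuous_real[OF continuous_on_subset[OF \<tau>]])+
  qed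
  \<comment> \<open>Moving \<open>\<theta>\<close> in the direction \<open>\<sigma>\<close> works against the torsion and must be paid for in \<open>\<integral>\<bar>w\<bar>\<close>.\<close>
  have step: "\<sigma> * (\<theta> t - \<theta> s) + c * (t - s) \<le> S"
    if st: "a \<le> s" "s \<le> t" "t \<le> b" for s t
  proof -
    have "\<theta> t - \<theta> s = integral {s..t} w - integral {s..t} \<tau>"
      using FTC[OF st] wi'[of s t] \<tau>i[of s t] st
      by (simp add: has_integral_iff Henstock_Kurzweil_Integration.integral_diff)
    then have "\<sigma> * (\<theta> t - \<theta> s) = integral {s..t} (\<lambda>x. \<sigma> * w x) - integral {s..t} (\<lambda>x. \<sigma> * \<tau> x)"
      by (simp add: right_diff_distrib)
    moreover have "integral {s..t} (\<lambda>x. \<sigma> * w x) \<le> integral {s..t} (\<lambda>x. \<bar>w x\<bar>)"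
    proof (rule integral_le)
      show "\<sigma> * w x \<le> \<bar>w x\<bar>" for x
        using abs_ge_self[of "\<sigma> * w x"] \<sigma> by (simp add: abs_mult)
      show "(\<lambda>x. \<sigma> * w x) integrable_on {s..t}"
        using wi'[of s t] st by (intro integrable_on_mult_right) auto
    qed (use absw'[of s t] st in auto)
    moreover have "integral {s..t} (\<lambda>x. \<bar>w x\<bar>) \<le> S"
      unfolding S_def using st absw' by (intro integral_subset_le absw) auto
    moreover have "integral {s..t} (\<lambda>x. c) \<le> integral {s..t} (\<lambda>x. \<sigma> * \<tau> x)"
      using st c \<tau>i[of s t] by (intro integral_le integrable_on_mult_right) auto
    ultimately show ?thesis
      using st by (simp add: mult.commute)
  qed
  have h: "h > 0" "c * h \<le> S"
    using step[of a b] ab sing by (auto simp: h_def)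
  then have S: "S > 0"
    using c by (smt (verit) mult_pos_pos)
  have cosS: "\<bar>cos (\<theta> t)\<bar> \<le> S" if t: "t \<in> {a..b}" for t
  proof -
    \<comment> \<open>One bound comes from \<open>[a,t]\<close>, the other from \<open>[t,b]\<close> together with \<open>\<theta> b = \<theta> a\<close>.\<close>
    have "\<sigma> * (\<theta> t - \<theta> a) \<le> S" "\<sigma> * (\<theta> a - \<theta> t) \<le> S"
      using step[of a t] step[of t b] t c sing
      by (auto simp: mult_nonneg_nonneg intro: order_trans[rotated])
    then have "\<bar>\<theta> t - \<theta> a\<bar> \<le> S"
      using \<sigma> by (auto simp: abs_if split: if_splits)
    then show ?thesis
      using abs_cos_diff_le[of "\<theta> t" "\<theta> a"] sing by simp
  qed
  \<comment> \<open>The mean of \<open>\<bar>w\<bar>\<close>, the optimal point of tangency.\<close>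
  define m where "m = S / h"
  define L where "L t = (4 * m ^ 3 * \<bar>w t\<bar> - 3 * m ^ 4) / (K\<^sup>2 * S\<^sup>2)" for t
  have intL: "integrable (lebesgue_on {a..b}) L"
    unfolding L_def using absolutely_integrable_imp_integrable[OF absolutely_integrable_abs[OF w]]
    by (intro integrable_divide Bochner_Integration.integrable_diff integrable_mult_right
        absolutely_integrable_imp_integrable[OF absolutely_integrable_on_const]) auto
  have "(LINT t|lebesgue_on {a..b}. L t) = integral {a..b} L"
    by (intro lebesgue_integral_eq_integral intL) auto
  also have "\<dots> = (4 * m ^ 3 * S - 3 * m ^ 4 * h) / (K\<^sup>2 * S\<^sup>2)"
  proof (rule integral_unique)
    have "((\<lambda>t. (4 * m ^ 3 * \<bar>w t\<bar> - 3 * m ^ 4)) has_integral (4 * m ^ 3 * S - h *\<^sub>R (3 * m ^ 4))) {a..b}"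
      unfolding S_def h_def using ab absw
      by (intro has_integral_diff has_integral_mult_right integrable_integral
          has_integral_const_real[of _ a b, THEN has_integral_eq_rhs]) auto
    then show "(L has_integral (4 * m ^ 3 * S - 3 * m ^ 4 * h) / (K\<^sup>2 * S\<^sup>2)) {a..b}"
      unfolding L_def by (intro has_integral_divide) (simp add: mult.commute)
  qed
  also have "\<dots> = S\<^sup>2 / (h ^ 3 * K\<^sup>2)"
    using h S K unfolding m_def
    by (simp add: field_simps power2_eq_square power3_eq_cube power4_eq_xxxx)
  finally have "ennreal (S\<^sup>2 / (h ^ 3 * K\<^sup>2)) \<le> (\<integral>\<^sup>+ t. ennreal (L t) \<partial>lebesgue_on {a..b})"
    using ennreal_integral_le_nn_integral[OF intL] by simp
  also have "\<dots> \<le> (\<integral>\<^sup>+ t. energy_density (\<kappa> t) (\<tau> t) (\<theta> t) (w t - \<tau> t) \<partial>lebesgue_on {a..b})"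
  proof (rule nn_integral_mono)
    fix t
    assume "t \<in> space (lebesgue_on {a..b})"
    then have t: "t \<in> {a..b}" by simp
    have "ennreal (L t) \<le> ennreal (w t ^ 4 / (K\<^sup>2 * S\<^sup>2))"
      unfolding L_def by (intro ennreal_leI divide_right_mono power4_above_tangent) simp
    also have "\<dots> \<le> energy_density (\<kappa> t) (\<tau> t) (\<theta> t) (w t - \<tau> t)"
      using energy_density_ge[of "\<kappa> t" K "\<theta> t" S "w t - \<tau> t" "\<tau> t"] \<kappa>[OF t] cosS[OF t] S by simp
    finally show "ennreal (L t) \<le> energy_density (\<kappa> t) (\<tau> t) (\<theta> t) (w t - \<tau> t)" .
  qed
  also have "\<dots> \<le> ennreal E" by (rule E)
  finally have "S\<^sup>2 / (h ^ 3 * K\<^sup>2) \<le> E"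
    using \<open>E \<ge> 0\<close> by simp
  then have "S\<^sup>2 \<le> E * (h ^ 3 * K\<^sup>2)"
    using h K by (simp add: pos_divide_le_eq)
  moreover have "(c * h)\<^sup>2 \<le> S\<^sup>2"
    using h c by (intro power_mono) auto
  ultimately have "h\<^sup>2 * c\<^sup>2 \<le> h\<^sup>2 * (h * K\<^sup>2 * E)"
    by (simp add: power2_eq_square power3_eq_cube mult_ac)
  then show ?thesis
    using h by (simp add: h_def)
qed

section \<open>Regularity of curvature and torsion\<close>

text \<open>Differentiating \<open>N = T' / \<bar>T'\<bar>\<close> expresses the torsion through the first three derivatives of
  the curve, with powers of the nonvanishing \<open>\<bar>T'\<bar>\<close> as the only denominators.\<close>

lemma continuous_curvature_torsion:
  fixes \<gamma> :: "real \<Rightarrow> real ^ 3"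
  assumes l: "l > 0" and C3: "Ck_on 3 {0..l} \<gamma>"
    and pos: "\<And>t. t \<in> {0..l} \<Longrightarrow> curvature_on {0..l} \<gamma> t > 0"
  shows "continuous_on {0..l} (curvature_on {0..l} \<gamma>)"
    and "continuous_on {0..l} (torsion_on {0..l} \<gamma>)"
proof -
  define S where "S = {0..l}"
  define T where "T = tangent_on S \<gamma>"
  define A where "A = vderiv_on S T"
  define J where "J = vderiv_on S A"
  have ders: "\<forall>j<3. ((vderiv_on S ^^ j) \<gamma>) differentiable_on S"
    and J: "continuous_on S J"
    using C3 by (auto simp: Ck_on_def S_def J_def A_def T_def tangent_on_def numeral_3_eq_3)
  from ders[rule_format, of 1] ders[rule_format, of 2]
  have dT: "T differentiable_on S" and dA: "A differentiable_on S"
    by (simp_all add: A_def T_def tangent_on_def numeral_2_eq_2)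
  note cT = differentiable_imp_continuous_on[OF dT]
  note cA = differentiable_imp_continuous_on[OF dA]
  have \<kappa>: "curvature_on S \<gamma> = (\<lambda>t. norm (A t))"
    by (auto simp: curvature_on_def A_def T_def)
  then show "continuous_on {0..l} (curvature_on {0..l} \<gamma>)"
    using cA by (simp add: S_def continuous_on_norm)
  have A0: "A t \<noteq> 0" if "t \<in> S" for t
    using pos[of t] that \<kappa> by (auto simp: S_def)
  define N where "N t = inverse (norm (A t)) *\<^sub>R A t" for t
  have N: "normal_on S \<gamma> = N"
    by (auto simp: normal_on_def N_def \<kappa> A_def T_def)
  define D where "D t = inverse (norm (A t)) *\<^sub>R J t +
      (- (inverse (norm (A t)) * (J t \<bullet> sgn (A t)) * inverse (norm (A t)))) *\<^sub>R A t" for t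
  have D: "vderiv_on S N t = D t" if t: "t \<in> S" for t
  proof -
    have A': "(A has_vector_derivative J t) (at t within S)"
      using dA t by (simp add: J_def vderiv_on_def differentiable_on_def
          vector_derivative_works[symmetric])
    have "((\<lambda>t. norm (A t)) has_derivative (\<lambda>h. (h *\<^sub>R J t) \<bullet> sgn (A t))) (at t within S)"
      by (rule has_derivative_compose[where f = A and g = norm])
        (use A' has_derivative_norm[OF A0[OF t]] in \<open>simp_all add: has_vector_derivative_def\<close>)
    then have "((\<lambda>t. norm (A t)) has_field_derivative J t \<bullet> sgn (A t)) (at t within S)"
      by (simp add: has_field_derivative_def mult.commute[of _ "J t \<bullet> sgn (A t)"])
    then have "((\<lambda>t. inverse (norm (A t))) has_field_derivative
        - (inverse (norm (A t)) * (J t \<bullet> sgn (A t)) * inverse (norm (A t)))) (at t within S)"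
      by (rule DERIV_inverse') (simp add: A0 t)
    then have "(N has_vector_derivative D t) (at t within S)"
      unfolding N_def D_def by (rule has_vector_derivative_scaleR[OF _ A'])
    then show ?thesis
      using vector_derivative_within_closed_interval[OF l, of t N "D t"] t
      by (simp add: vderiv_on_def S_def)
  qed
  have "continuous_on S (\<lambda>t. D t \<bullet> cross3 (T t) (N t))"
    unfolding D_def N_def sgn_div_norm
    using A0 by (intro continuous_intros continuous_on_cross cT cA J) auto
  moreover have "torsion_on S \<gamma> t = D t \<bullet> cross3 (T t) (N t)" if "t \<in> S" for t
    using D[OF that] by (simp add: torsion_on_def binormal_on_def N T_def)
  ultimately show "continuous_on {0..l} (torsion_on {0..l} \<gamma>)"
    unfolding S_def[symmetric] using continuous_on_cong by fastforce
qed

section \<open>Isolation of singular points\<close>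

lemma singular_points_near_eq:
  assumes "singular_point l \<theta> s" "singular_point l \<theta> t" "\<bar>\<theta> t - \<theta> s\<bar> < pi"
  shows "\<theta> t = \<theta> s"
proof -
  obtain j k :: int where jk: "\<theta> s = pi / 2 + pi * of_int j" "\<theta> t = pi / 2 + pi * of_int k"
    using assms by (auto simp: singular_point_def)
  with assms(3) have "\<bar>pi * of_int (k - j)\<bar> < pi * 1"
    by (simp add: algebra_simps)
  then have "\<bar>real_of_int (k - j)\<bar> < 1"
    by (simp only: abs_mult abs_of_pos[OF pi_gt_zero] mult_less_cancel_left_pos[OF pi_gt_zero])
  then show ?thesis using jk by simp
qed

lemma singular_point_cos: "singular_point l \<theta> t \<Longrightarrow> cos (\<theta> t) = 0"
  by (auto simp: singular_point_def cos_add sin_zero_iff_int2 mult.commute)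

theorem theorem1p5:
  fixes l t0 :: real and \<gamma> :: "real \<Rightarrow> real ^ 3" and \<theta>min :: "real \<Rightarrow> real"
  assumes "l > 0"
    and "Ck_on 3 {0..l} \<gamma>"
    and "unit_speed_on {0..l} \<gamma>"
    and "\<forall>t\<in>{0..l}. curvature_on {0..l} \<gamma> t > 0"
    and "energy_minimizer l (curvature_on {0..l} \<gamma>) (torsion_on {0..l} \<gamma>) \<theta>min"
    and "singular_point l \<theta>min t0"
    and "torsion_on {0..l} \<gamma> t0 \<noteq> 0"
  shows "\<exists>\<epsilon>>0. \<forall>t\<in>{t0 - \<epsilon><..<t0 + \<epsilon>} \<inter> {0..l}. singular_point l \<theta>min t \<longrightarrow> t = t0"
proof -
  define \<kappa> where "\<kappa> = curvature_on {0..l} \<gamma>"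
  define \<tau> where "\<tau> = torsion_on {0..l} \<gamma>"
  define \<theta> where "\<theta> = \<theta>min"
  have c\<kappa>: "continuous_on {0..l} \<kappa>" and c\<tau>: "continuous_on {0..l} \<tau>"
    unfolding \<kappa>_def \<tau>_def using assms(1,2,4) by (auto intro: continuous_curvature_torsion)
  have pos: "\<kappa> t > 0" if "t \<in> {0..l}" for t
    using assms(4) that by (simp add: \<kappa>_def)
  have min: "energy_minimizer l \<kappa> \<tau> \<theta>" and sing: "singular_point l \<theta> t0" and \<tau>0: "\<tau> t0 \<noteq> 0"
    using assms(5-7) by (simp_all add: \<kappa>_def \<tau>_def \<theta>_def)
  have t0: "t0 \<in> {0..l}"
    using sing by (simp add: singular_point_def)

  have "compact (\<kappa> ` {0..l})"
    by (intro compact_continuous_image c\<kappa>) simp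
  then obtain K where "K > 0" and "\<And>y. y \<in> \<kappa> ` {0..l} \<Longrightarrow> norm y \<le> K"
    using bounded_pos compact_imp_bounded by metis
  then have \<kappa>K: "0 < \<kappa> t \<and> \<kappa> t \<le> K" if "t \<in> {0..l}" for t
    using pos[OF that] that by fastforce

  have fin: "energy l \<kappa> \<tau> \<theta> < \<infinity>"
    using min energy_of_zero_finite[OF c\<kappa> pos c\<tau>]
    by (auto simp: energy_minimizer_def intro: le_less_trans)
  then obtain E where E: "energy l \<kappa> \<tau> \<theta> = ennreal E" "E \<ge> 0"
    by (cases "energy l \<kappa> \<tau> \<theta>") auto
  obtain g where c\<theta>: "continuous_on {0..l} \<theta>" and wd: "has_weak_deriv l \<theta> g"
    using min by (auto simp: energy_minimizer_def W14_def)
  define w where "w t = weak_deriv l \<theta> t + \<tau> t" for t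
  have w: "w absolutely_integrable_on {0..l}"
    unfolding w_def by (rule finite_energy_absolutely_integrable[OF c\<tau> \<kappa>K \<open>K > 0\<close> wd fin])
  have "(\<lambda>t. w t - \<tau> t) integrable_on {0..l}"
    by (rule Henstock_Kurzweil_Integration.integrable_diff[OF
          set_lebesgue_integral_eq_integral(1)[OF w] integrable_continuous_real[OF c\<tau>]])
  then have "weak_deriv l \<theta> integrable_on {0..l}"
    by (simp add: w_def)
  then have FTC: "((\<lambda>x. w x - \<tau> x) has_integral (\<theta> t - \<theta> s)) {s..t}"
    if "0 \<le> s" "s \<le> t" "t \<le> l" for s t
    using weak_derivative_FTC[OF c\<theta> has_weak_deriv_weak_deriv[OF wd]] that by (simp add: w_def)

  define \<sigma> where "\<sigma> = sgn (\<tau> t0)"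
  define c where "c = \<bar>\<tau> t0\<bar> / 2"
  have c: "c > 0" and \<sigma>: "\<bar>\<sigma>\<bar> = 1" and \<sigma>c: "\<sigma> * \<tau> t0 = 2 * c"
    using \<tau>0 by (auto simp: c_def \<sigma>_def abs_sgn_eq mult_sgn_abs abs_mult_sgn sgn_if)
  obtain d1 where d1: "d1 > 0" "\<And>t. t \<in> {0..l} \<Longrightarrow> \<bar>t - t0\<bar> < d1 \<Longrightarrow> \<bar>\<tau> t - \<tau> t0\<bar> < c"
    using c\<tau> t0 c unfolding continuous_on_iff dist_real_def by blast
  obtain d2 where d2: "d2 > 0" "\<And>t. t \<in> {0..l} \<Longrightarrow> \<bar>t - t0\<bar> < d2 \<Longrightarrow> \<bar>\<theta> t - \<theta> t0\<bar> < pi"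
    using c\<theta> t0 pi_gt_zero unfolding continuous_on_iff dist_real_def by blast
  \<comment> \<open>Two singular points this close contradict the gap estimate; the summand \<open>1\<close> covers \<open>E = 0\<close>.\<close>
  define d3 where "d3 = c\<^sup>2 / (K\<^sup>2 * (E + 1))"
  have d3: "d3 > 0"
    using c \<open>K > 0\<close> E by (simp add: d3_def)
  define \<epsilon> where "\<epsilon> = min d1 (min d2 d3)"
  have "t = t0" if t: "t \<in> {0..l}" "\<bar>t - t0\<bar> < \<epsilon>" and st: "singular_point l \<theta> t" for t
  proof (rule ccontr)
    assume "t \<noteq> t0"
    define a where "a = min t t0"
    define b where "b = max t t0"
    have ab: "a < b" "0 \<le> a" "b \<le> l" "b - a = \<bar>t - t0\<bar>"
      using \<open>t \<noteq> t0\<close> t t0 by (auto simp: a_def b_def)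
    then have sub: "{a..b} \<subseteq> {0..l}" by auto
    have near: "\<bar>x - t0\<bar> < d1" if "x \<in> {a..b}" for x
      using that t by (auto simp: a_def b_def \<epsilon>_def)
    have eq: "\<theta> t = \<theta> t0"
      using singular_points_near_eq[OF sing st] d2(2)[of t] t by (simp add: \<epsilon>_def)
    have "c\<^sup>2 \<le> (b - a) * K\<^sup>2 * E"
    proof (rule singular_points_gap[where w = w and \<tau> = \<tau> and \<theta> = \<theta> and \<sigma> = \<sigma> and \<kappa> = \<kappa>])
      show "w absolutely_integrable_on {a..b}"
        by (rule set_integrable_subset[OF w]) (use sub in auto)
      show "continuous_on {a..b} \<tau>"
        using c\<tau> sub by (rule continuous_on_subset)
      show "((\<lambda>x. w x - \<tau> x) has_integral (\<theta> v - \<theta> u)) {u..v}" if "a \<le> u" "u \<le> v" "v \<le> b" for u v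
        using that ab by (intro FTC) auto
      show "\<sigma> * \<tau> x \<ge> c" if "x \<in> {a..b}" for x
      proof -
        have "\<bar>\<sigma> * (\<tau> x - \<tau> t0)\<bar> < c"
          using d1(2)[of x] near[OF that] that sub \<sigma> by (auto simp: abs_mult)
        then show ?thesis
          using \<sigma>c by (simp add: right_diff_distrib)
      qed
      show "cos (\<theta> a) = 0"
        using singular_point_cos[OF sing] singular_point_cos[OF st] by (simp add: a_def min_def)
      show "\<theta> b = \<theta> a"
        using eq by (simp add: a_def b_def min_def max_def)
      show "0 < \<kappa> x \<and> \<kappa> x \<le> K" if "x \<in> {a..b}" for x
        using \<kappa>K sub that by blast
      have "(\<integral>\<^sup>+ t. energy_density (\<kappa> t) (\<tau> t) (\<theta> t) (w t - \<tau> t) \<partial>lebesgue_on {a..b}) \<le>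
          energy l \<kappa> \<tau> \<theta>"
        unfolding energy_def w_def using sub
        by (subst (1 2) nn_integral_restrict_space)
          (auto intro!: nn_integral_mono simp: indicator_def)
      then show "(\<integral>\<^sup>+ t. energy_density (\<kappa> t) (\<tau> t) (\<theta> t) (w t - \<tau> t) \<partial>lebesgue_on {a..b}) \<le>
          ennreal E"
        by (simp only: E)
    qed (use ab \<sigma> c E in auto)
    also have "\<dots> \<le> (b - a) * (K\<^sup>2 * (E + 1))"
      unfolding mult.assoc using ab by (intro mult_left_mono) auto
    also have "\<dots> < d3 * (K\<^sup>2 * (E + 1))"
      using ab t E \<open>K > 0\<close> by (intro mult_strict_right_mono) (auto simp: \<epsilon>_def)
    also have "\<dots> = c\<^sup>2"
      using E \<open>K > 0\<close> by (simp add: d3_def)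
    finally show False by simp
  qed
  moreover have "\<epsilon> > 0"
    using d1 d2 d3 by (simp add: \<epsilon>_def)
  ultimately show ?thesis
    unfolding \<theta>_def by (intro exI[of _ \<epsilon>]) (auto simp: abs_if)
qed

end
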